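(* Let $X$ and $Y$ be disjoint sets of vertices. Let $H$ be the hypergraph on the vertex set $X\cup Y$ whose edges are all possible edges of size $k$ (that is, all $k$-element subsets of $X\cup Y$) having a non-empty intersection with both $X$ and $Y$. If $|X|\geq |Y|\geq 2k-1$, then $H$ is a $k$-uniform 2-line existentially closed hypergraph.
   Context: A hypergraph is a pair $(V,E)$ with $V$ a set of distinct vertices and $E$ a collection of subsets of $V$ called edges; it is $k$-uniform if all its edges have the same cardinality $k$. Two edges of a hypergraph are adjacent if and only if they share at least one vertex. The line graph of a hypergraph has the edges of the hypergraph as its vertices, with adjacency given by adjacency of edges. A graph with at least 2 vertices is 2-existentially closed if, for all disjoint sets of vertices $A$ and $B$ with $|A\cup B|=2$ (either may be empty), there is a vertex $z\notin A\cup B$ adjacent to each vertex of $A$ and to no vertex of $B$. A hypergraph is 2-line existentially closed (2-line e.c.) if its line graph is 2-existentially closed; that is, for all disjoint sets of edges $A$ and $B$ with $|A\cup B|=2$, there is an edge not in $A\cup B$ that is adjacent to each edge of $A$ and to no edge of $B$. *)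

theory Defs
  imports Main "HOL-Library.Equipollence"
begin

type_synonym 'a hypergraph = "'a set \<times> 'a set set"

abbreviation verts :: "'a hypergraph \<Rightarrow> 'a set" where
  "verts \<equiv> fst"

abbreviation edges :: "'a hypergraph \<Rightarrow> 'a set set" where
  "edges \<equiv> snd"

definition hypergraph :: "'a hypergraph \<Rightarrow> bool" where
  "hypergraph H \<longleftrightarrow> (\<forall>e \<in> edges H. e \<subseteq> verts H)"

text \<open>The explicit finiteness matters for \<open>k = 0\<close> only, since \<open>card\<close> is \<open>0\<close> on infinite sets.\<close>

definition uniform :: "nat \<Rightarrow> 'a hypergraph \<Rightarrow> bool" where
  "uniform k H \<longleftrightarrow> (\<forall>e \<in> edges H. finite e \<and> card e = k)"

text \<open>Simple graphs are the 2-uniform hypergraphs.\<close>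

definition graph :: "'a hypergraph \<Rightarrow> bool" where
  "graph G \<longleftrightarrow> hypergraph G \<and> uniform 2 G"

definition adjacent :: "'a hypergraph \<Rightarrow> 'a \<Rightarrow> 'a \<Rightarrow> bool" where
  "adjacent G u v \<longleftrightarrow> {u, v} \<in> edges G"

definition line_graph :: "'a hypergraph \<Rightarrow> 'a set hypergraph" where
  "line_graph H =
    (edges H, {{e, f} | e f. e \<in> edges H \<and> f \<in> edges H \<and> e \<noteq> f \<and> e \<inter> f \<noteq> {}})"

lemma graph_line_graph: "graph (line_graph H)"
  unfolding graph_def
proof
  show "hypergraph (line_graph H)"
    unfolding hypergraph_def
  proof
    fix d assume "d \<in> edges (line_graph H)"
    then obtain e f where "d = {e, f}" "e \<in> edges H" "f \<in> edges H"
      unfolding line_graph_def snd_conv mem_Collect_eq by (elim exE conjE)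
    then show "d \<subseteq> verts (line_graph H)"
      by (simp add: line_graph_def)
  qed
  show "uniform 2 (line_graph H)"
    unfolding uniform_def
  proof
    fix d assume "d \<in> edges (line_graph H)"
    then obtain e f where "d = {e, f}" "e \<noteq> f"
      unfolding line_graph_def snd_conv mem_Collect_eq by (elim exE conjE)
    then show "finite d \<and> card d = 2"
      by simp
  qed
qed

lemma adjacent_line_graph:
  "adjacent (line_graph H) e f \<longleftrightarrow>
    e \<in> edges H \<and> f \<in> edges H \<and> e \<noteq> f \<and> e \<inter> f \<noteq> {}"
  unfolding adjacent_def line_graph_def snd_conv mem_Collect_eq doubleton_eq_iff by blast

text \<open>Vertex sets may be infinite; the first conjunct says that there are at least two vertices.\<close>

definition two_ec :: "'a hypergraph \<Rightarrow> bool" where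
  "two_ec G \<longleftrightarrow>
    (infinite (verts G) \<or> 2 \<le> card (verts G)) \<and>
    (\<forall>A B. A \<subseteq> verts G \<and> B \<subseteq> verts G \<and> A \<inter> B = {} \<and> card (A \<union> B) = 2 \<longrightarrow>
      (\<exists>z \<in> verts G. z \<notin> A \<union> B \<and> (\<forall>a \<in> A. adjacent G z a) \<and> (\<forall>b \<in> B. \<not> adjacent G z b)))"

definition two_line_ec :: "'a hypergraph \<Rightarrow> bool" where
  "two_line_ec H \<longleftrightarrow> two_ec (line_graph H)"

definition crossing_hypergraph :: "nat \<Rightarrow> 'a set \<Rightarrow> 'a set \<Rightarrow> 'a hypergraph" where
  "crossing_hypergraph k X Y =
    (X \<union> Y,
     {e. e \<subseteq> X \<union> Y \<and> finite e \<and> card e = k \<and> e \<inter> X \<noteq> {} \<and> e \<inter> Y \<noteq> {}})"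

text \<open>For \<open>k \<le> 1\<close> the line graph has no vertices, so it cannot be 2-existentially closed.\<close>

lemma crossing_hypergraph_degenerate:
  assumes "X \<inter> Y = {}" "k < 2"
  shows "edges (crossing_hypergraph k X Y) = {}"
proof -
  have False if "e \<in> edges (crossing_hypergraph k X Y)" for e
  proof -
    have "finite e" "card e = k" "e \<inter> X \<noteq> {}" "e \<inter> Y \<noteq> {}"
      using that unfolding crossing_hypergraph_def snd_conv mem_Collect_eq by blast+
    then obtain x y where xy: "{x, y} \<subseteq> e" "x \<in> X" "y \<in> Y"
      by blast
    then have "x \<noteq> y"
      using assms(1) by blast
    then show False
      using card_mono[OF \<open>finite e\<close> xy(1)] \<open>card e = k\<close> assms(2) by simp
  qed
  then show ?thesis
    by blast
qed

lemma not_two_line_ec_degenerate: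
  assumes "X \<inter> Y = {}" "k < 2"
  shows "\<not> two_line_ec (crossing_hypergraph k X Y)"
  using crossing_hypergraph_degenerate[OF assms]
  by (simp add: two_line_ec_def two_ec_def line_graph_def)

end

theory Submission imports Defs
begin

text \<open>
  An edge has at most \<open>k - 1\<close> vertices on either side, as it also has one on the other side. Hence
  two edges together leave a vertex uncovered on each of \<open>X\<close> and \<open>Y\<close>. An edge containing such a
  vertex differs from both given edges, and there is always room to extend a crossing pair to an
  edge avoiding at most \<open>2k\<close> given vertices, since \<open>|X| + |Y| \<ge> 4k - 2 \<ge> 3k\<close>.
\<close>

text \<open>Since \<open>card\<close> is 0 on infinite sets, largeness has to be a disjunction; this
  passes to a finite set of exact size, so that later counting is finite in both cases.\<close>

lemma ex_finite_large_subset: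
  assumes "infinite S \<or> n \<le> card S"
  obtains T where "T \<subseteq> S" "finite T" "card T = n"
proof (cases "finite S")
  case True
  then show thesis
    using assms obtain_subset_with_card_n[of n S] that by blast
next
  case False
  then show thesis
    using infinite_arbitrarily_large[of S n] that by blast
qed

text \<open>Bounding both sides from below makes the hypotheses symmetric in \<open>X\<close> and
  \<open>Y\<close>.\<close>

locale large_crossing =
  fixes X Y :: "'a set" and k :: nat
  assumes k: "2 \<le> k"
    and disj: "X \<inter> Y = {}"
    and large_X: "infinite X \<or> 2 * k - 1 \<le> card X"
    and large_Y: "infinite Y \<or> 2 * k - 1 \<le> card Y"
begin

abbreviation crossing_edges :: "'a set set" where
  "crossing_edges \<equiv> edges (crossing_hypergraph k X Y)"

lemma crossing_edges_iff:
  "e \<in> crossing_edges \<longleftrightarrow>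
    e \<subseteq> X \<union> Y \<and> finite e \<and> card e = k \<and> e \<inter> X \<noteq> {} \<and> e \<inter> Y \<noteq> {}"
  by (simp add: crossing_hypergraph_def)

lemma edge_extending_pair:
  assumes "x \<in> X" "y \<in> Y" "x \<notin> F" "y \<notin> F" "finite F" "card F \<le> 2 * k"
  shows "\<exists>z\<in>crossing_edges. x \<in> z \<and> y \<in> z \<and> z \<inter> F = {}"
proof -
  obtain S where S: "S \<subseteq> X" "finite S" "card S = 2 * k - 1"
    using ex_finite_large_subset[OF large_X] .
  obtain T where T: "T \<subseteq> Y" "finite T" "card T = 2 * k - 1"
    using ex_finite_large_subset[OF large_Y] .
  \<comment> \<open>A finite pool of permitted vertices; \<open>x\<close> and \<open>y\<close> are
    added by hand because \<open>S\<close> and \<open>T\<close> need not contain them.\<close>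
  define D where "D = {x, y} \<union> (S \<union> T - F)"
  have "finite D"
    using S T by (simp add: D_def)
  have "card (S \<union> T) = (2 * k - 1) + (2 * k - 1)"
    using S T disj by (subst card_Un_disjoint) auto
  \<comment> \<open>At least (4k - 2) - 2k = 2k - 2 vertices remain, and this is \<ge> k because k
    \<ge> 2.\<close>
  then have "k \<le> card (S \<union> T - F)"
    using diff_card_le_card_Diff[OF \<open>finite F\<close>, of "S \<union> T"] assms(6) k by linarith
  also have "\<dots> \<le> card D"
    using \<open>finite D\<close> by (intro card_mono) (auto simp: D_def)
  finally have "k \<le> card D" .
  moreover have "card {x, y} \<le> k"
    using k card_insert_le_m1[of 2 "{y}" x] by simp
  moreover have "{x, y} \<subseteq> D"
    by (simp add: D_def)
  ultimately obtain z where z: "{x, y} \<subseteq> z" "z \<subseteq> D" "card z = k"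
    using exists_subset_between[of "{x, y}" k D] \<open>finite D\<close> by blast
  have "finite z"
    using z(2) \<open>finite D\<close> finite_subset by blast
  moreover have "z \<subseteq> X \<union> Y"
    using z(2) S(1) T(1) assms(1,2) unfolding D_def by blast
  ultimately have "z \<in> crossing_edges"
    unfolding crossing_edges_iff using z(1,3) assms(1,2) by blast
  moreover have "z \<inter> F = {}"
    using z(2) assms(3,4) unfolding D_def by blast
  ultimately show ?thesis
    using z(1) by blast
qed

lemma uncovered_vertex:
  assumes e: "e \<in> crossing_edges" and f: "f \<in> crossing_edges"
    and S: "S = X \<or> S = Y"
  shows "\<exists>w\<in>S. w \<notin> e \<and> w \<notin> f"
proof -
  have less: "finite (g \<inter> S) \<and> card (g \<inter> S) < k" if "g \<in> crossing_edges" for g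
  proof -
    have "finite g" "card g = k" "g \<inter> S \<subset> g"
      using that S disj unfolding crossing_edges_iff by auto
    then show ?thesis
      using psubset_card_mono[of g "g \<inter> S"] by simp
  qed
  \<comment> \<open>At most 2(k - 1) vertices are covered, one short of the assumed size of a
    side.\<close>
  have "card ((e \<inter> S) \<union> (f \<inter> S)) < 2 * k - 1"
    using card_Un_le[of "e \<inter> S" "f \<inter> S"] less[OF e] less[OF f] by linarith
  moreover have "finite ((e \<inter> S) \<union> (f \<inter> S))"
    using less[OF e] less[OF f] by simp
  moreover have "infinite S \<or> 2 * k - 1 \<le> card S"
    using S large_X large_Y by blast
  ultimately have "S \<noteq> (e \<inter> S) \<union> (f \<inter> S)"
    by (metis not_less)
  then show ?thesis
    by blast
qed

text \<open>Pair \<open>v\<close> with a vertex of the opposite side outside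
  \<open>e \<union> f\<close>: it avoids \<open>F\<close> and keeps the new edge distinct from
  \<open>e\<close> and \<open>f\<close>. The set \<open>F\<close> will be \<open>{}\<close>,
  \<open>f\<close> or \<open>e \<union> f\<close>.\<close>

lemma edge_through_vertex:
  assumes e: "e \<in> crossing_edges" and f: "f \<in> crossing_edges"
    and v: "v \<in> X \<union> Y" "v \<notin> F" and F: "F \<subseteq> e \<union> f"
  shows "\<exists>z\<in>crossing_edges. v \<in> z \<and> z \<inter> F = {} \<and> z \<noteq> e \<and> z \<noteq> f"
proof -
  have fin: "finite (e \<union> f)" and "card (e \<union> f) \<le> 2 * k"
    using e f card_Un_le[of e f] by (simp_all add: crossing_edges_iff)
  then have card_F: "finite F" "card F \<le> 2 * k"
    using finite_subset[OF F fin] card_mono[OF fin F] by auto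
  obtain x where x: "x \<in> X" "x \<notin> e" "x \<notin> f"
    using uncovered_vertex[OF e f] by blast
  obtain y where y: "y \<in> Y" "y \<notin> e" "y \<notin> f"
    using uncovered_vertex[OF e f] by blast
  show ?thesis
  proof (cases "v \<in> X")
    case True
    then show ?thesis
      using edge_extending_pair[of v y F] y v F card_F by blast
  next
    case False
    then show ?thesis
      using edge_extending_pair[of x v F] x v F card_F by blast
  qed
qed

text \<open>Distinct edges have the same finite size, so \<open>e\<close> has a vertex outside
  \<open>f\<close>; an edge through it can avoid \<open>f\<close>.\<close>

lemma edge_meeting_one:
  assumes e: "e \<in> crossing_edges" and f: "f \<in> crossing_edges" and "e \<noteq> f"
  shows "\<exists>z\<in>crossing_edges. z \<inter> e \<noteq> {} \<and> z \<inter> f = {} \<and> z \<noteq> e \<and> z \<noteq> f"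
proof -
  have "\<not> e \<subseteq> f"
    using e f \<open>e \<noteq> f\<close> card_subset_eq[of f e] unfolding crossing_edges_iff by auto
  then obtain v where "v \<in> e" "v \<notin> f"
    by blast
  moreover from this have "v \<in> X \<union> Y"
    using e unfolding crossing_edges_iff by blast
  ultimately show ?thesis
    using edge_through_vertex[OF e f, of v f] by blast
qed

lemma edge_meeting_both:
  assumes e: "e \<in> crossing_edges" and f: "f \<in> crossing_edges"
  shows "\<exists>z\<in>crossing_edges. z \<inter> e \<noteq> {} \<and> z \<inter> f \<noteq> {} \<and> z \<noteq> e \<and> z \<noteq> f"
proof (cases "e \<inter> f = {}")
  case True
  \<comment> \<open>Any edge through \<open>x\<close> and \<open>y\<close> meets both; by
    disjointness \<open>y\<close> separates it from \<open>e\<close>, and \<open>x\<close> from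
    \<open>f\<close>.\<close>
  obtain x y where "x \<in> e" "x \<in> X" "y \<in> f" "y \<in> Y"
    using e f unfolding crossing_edges_iff by blast
  moreover from this obtain z where "z \<in> crossing_edges" "x \<in> z" "y \<in> z"
    using edge_extending_pair[of x y "{}"] by auto
  ultimately show ?thesis
    using True by blast
next
  case False
  \<comment> \<open>An edge through a common vertex meets both, so with \<open>F = {}\<close> only
    distinctness from \<open>e\<close> and \<open>f\<close> is at stake.\<close>
  then obtain v where "v \<in> e" "v \<in> f"
    by blast
  moreover from this have "v \<in> X \<union> Y"
    using e unfolding crossing_edges_iff by blast
  ultimately show ?thesis
    using edge_through_vertex[OF e f, of v "{}"] by blast
qed

lemma edge_meeting_neither:
  assumes e: "e \<in> crossing_edges" and f: "f \<in> crossing_edges"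
  shows "\<exists>z\<in>crossing_edges. z \<inter> e = {} \<and> z \<inter> f = {} \<and> z \<noteq> e \<and> z \<noteq> f"
proof -
  obtain x where "x \<in> X" "x \<notin> e \<union> f"
    using uncovered_vertex[OF e f] by blast
  then obtain z where "z \<in> crossing_edges" "x \<in> z" "z \<inter> (e \<union> f) = {}" "z \<noteq> e" "z \<noteq> f"
    using edge_through_vertex[OF e f, of x "e \<union> f"] by blast
  then show ?thesis
    by blast
qed

lemma ex_two_crossing_edges: "\<exists>e\<in>crossing_edges. \<exists>f\<in>crossing_edges. e \<noteq> f"
proof -
  have "X \<noteq> {}" "Y \<noteq> {}"
    using large_X large_Y k by auto
  then obtain x y where "x \<in> X" "y \<in> Y"
    by blast
  then obtain e where e: "e \<in> crossing_edges"
    using edge_extending_pair[of x y "{}"] by auto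
  \<comment> \<open>Taking the same edge twice yields a second edge, disjoint from the
    first.\<close>
  then obtain f where "f \<in> crossing_edges" "f \<noteq> e"
    using edge_meeting_neither[OF e e] by blast
  then show ?thesis
    using e by blast
qed

lemma two_line_ec_crossing_hypergraph: "two_line_ec (crossing_hypergraph k X Y)"
  unfolding two_line_ec_def two_ec_def
proof (intro conjI allI impI)
  have verts: "verts (line_graph (crossing_hypergraph k X Y)) = crossing_edges"
    by (simp add: line_graph_def)
  obtain e f where ef: "{e, f} \<subseteq> crossing_edges" "e \<noteq> f"
    using ex_two_crossing_edges by blast
  show "infinite (verts (line_graph (crossing_hypergraph k X Y))) \<or>
      2 \<le> card (verts (line_graph (crossing_hypergraph k X Y)))"
    unfolding verts using card_mono[OF _ ef(1)] ef(2) by auto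
  fix A B
  assume "A \<subseteq> verts (line_graph (crossing_hypergraph k X Y)) \<and>
    B \<subseteq> verts (line_graph (crossing_hypergraph k X Y)) \<and> A \<inter> B = {} \<and> card (A \<union> B) = 2"
  then have AB: "A \<union> B \<subseteq> crossing_edges" "A \<inter> B = {}" "card (A \<union> B) = 2"
    unfolding verts by auto
  then obtain e f where ef: "A \<union> B = {e, f}" "e \<noteq> f"
    by (meson card_2_iff)
  have e: "e \<in> crossing_edges" and f: "f \<in> crossing_edges"
    using AB(1) ef(1) by auto
  have "A \<in> Pow {e, f}" "B = {e, f} - A"
    using ef(1) AB(2) by auto
  then consider "A = {e, f}" "B = {}" | "A = {e}" "B = {f}" | "A = {f}" "B = {e}" | "A = {}" "B = {e, f}"
    using ef(2) by (auto simp: Pow_insert)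
  \<comment> \<open>As \<open>z\<close> lies outside \<open>A \<union> B\<close>, it differs from
    every member, so adjacency in the line graph reduces to intersection.\<close>
  then have "\<exists>z\<in>crossing_edges. z \<notin> A \<union> B \<and> (\<forall>a\<in>A. z \<inter> a \<noteq> {}) \<and> (\<forall>b\<in>B. z \<inter> b = {})"
  proof cases
    case 1
    show ?thesis
      unfolding 1 using edge_meeting_both[OF e f] by auto
  next
    case 2
    show ?thesis
      unfolding 2 using edge_meeting_one[OF e f ef(2)] by auto
  next
    case 3
    show ?thesis
      unfolding 3 using edge_meeting_one[OF f e ef(2)[symmetric]] by auto
  next
    case 4
    show ?thesis
      unfolding 4 using edge_meeting_neither[OF e f] by auto
  qed
  then show "\<exists>z\<in>verts (line_graph (crossing_hypergraph k X Y)). z \<notin> A \<union> B \<and>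
      (\<forall>a\<in>A. adjacent (line_graph (crossing_hypergraph k X Y)) z a) \<and>
      (\<forall>b\<in>B. \<not> adjacent (line_graph (crossing_hypergraph k X Y)) z b)"
    using AB(1) unfolding verts adjacent_line_graph by (elim bexE, intro bexI) auto
qed

end

text \<open>The bound 2 \<le> k excludes the edgeless case of
  \<open>not_two_line_ec_degenerate\<close>; \<open>\<lesssim>\<close> compares cardinalities for
  infinite sets too. The injection from \<open>Y\<close> transfers the size bound to a finite
  \<open>X\<close>.\<close>

theorem theorem15:
  fixes X Y :: "'a set" and k :: nat
  assumes "2 \<le> k"
    and "X \<inter> Y = {}"
    and "Y \<lesssim> X"
    and "infinite Y \<or> 2 * k - 1 \<le> card Y"
  shows "hypergraph (crossing_hypergraph k X Y) \<and>
    uniform k (crossing_hypergraph k X Y) \<and>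
    two_line_ec (crossing_hypergraph k X Y)"
proof -
  have "infinite X \<or> 2 * k - 1 \<le> card X"
  proof (cases "finite X")
    case True
    obtain g where "inj_on g Y" "g ` Y \<subseteq> X"
      using assms(3) unfolding lepoll_def by blast
    then have "finite Y" "card Y \<le> card X"
      using True inj_on_finite[of g Y X] card_inj_on_le[of g Y X] by simp_all
    then show ?thesis
      using assms(4) by simp
  qed simp
  then interpret large_crossing X Y k
    using assms by unfold_locales
  show ?thesis
  proof (intro conjI two_line_ec_crossing_hypergraph)
    show "hypergraph (crossing_hypergraph k X Y)" "uniform k (crossing_hypergraph k X Y)"
      by (simp_all add: hypergraph_def uniform_def crossing_hypergraph_def)
  qed
qed

end
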